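(* Let $n\ge 1$ and $r\ge 1$ be integers, let $\chi$ be a multiplicative character of $\mathbb{Z}_n^*$, and let $\lambda$ be the additive character $\lambda(x)=\exp\left(\frac{2\pi\sqrt{-1}\,ax}{n}\right)$ of $\mathbb{Z}_n$, where $a\in\mathbb{Z}$ satisfies $\gcd(a,n)=1$ (i.e. $\lambda$ has order $n$). Then $$G(\mathrm{GL}_r(\mathbb{Z}_n),\chi,\lambda)=G(\mathbb{Z}_n,\chi,\lambda)^r\, n^{\frac{r(r-1)}{2}}.$$
   Context: $\mathbb{Z}_n=\mathbb{Z}/n\mathbb{Z}$, $\mathbb{Z}_n^*$ is its unit group, and $\mathrm{GL}_r(\mathbb{Z}_n)$ is the group of invertible $r\times r$ matrices over $\mathbb{Z}_n$. The classical Gauss sum is $G(\mathbb{Z}_n,\chi,\lambda)=\sum_{x\in\mathbb{Z}_n^*}\chi(x)\lambda(x)$, and the Gauss sum for the general linear group is $G(\mathrm{GL}_r(\mathbb{Z}_n),\chi,\lambda)=\sum_{X\in\mathrm{GL}_r(\mathbb{Z}_n)}\chi(\det X)\lambda(\mathrm{tr}\,X)$. *)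

theory Defs
  imports Complex_Main "Jordan_Normal_Form.Determinant"
begin

text \<open>
  The ring of integers modulo \<open>n\<close> on the canonical representatives \<open>0, \<dots>, n - 1\<close>.
  The unit is \<open>1 mod n\<close> rather than the literal \<open>1\<close> of \<open>residue_ring\<close>, so that \<open>n = 1\<close> gives
  the zero ring.
\<close>

definition zmod :: "nat \<Rightarrow> int ring" where
  "zmod n = \<lparr>carrier = {0..<int n},
             mult = (\<lambda>x y. (x * y) mod int n),
             one = 1 mod int n,
             zero = 0,
             add = (\<lambda>x y. (x + y) mod int n)\<rparr>"

definition reduce_mat :: "nat \<Rightarrow> int mat \<Rightarrow> int mat" where
  "reduce_mat n = map_mat (\<lambda>x. x mod int n)"

definition mat_monoid :: "nat \<Rightarrow> nat \<Rightarrow> int mat monoid" where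
  "mat_monoid r n = \<lparr>carrier = {A \<in> carrier_mat r r. elements_mat A \<subseteq> carrier (zmod n)},
                     mult = (\<lambda>A B. reduce_mat n (A * B)),
                     one = reduce_mat n (1\<^sub>m r)\<rparr>"

definition GL :: "nat \<Rightarrow> nat \<Rightarrow> int mat set" where
  "GL r n = Units (mat_monoid r n)"

text \<open>
  Reduction modulo \<open>n\<close> is a ring homomorphism on the integers, so determinant and trace over
  the integers modulo \<open>n\<close> are the reductions of those of the matrix of representatives.
\<close>

definition det_mod :: "nat \<Rightarrow> int mat \<Rightarrow> int" where
  "det_mod n A = det A mod int n"

definition tr_mod :: "nat \<Rightarrow> int mat \<Rightarrow> int" where
  "tr_mod n A = (\<Sum>i<dim_row A. A $$ (i, i)) mod int n"

definition complex_units :: "complex monoid" where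
  "complex_units = \<lparr>carrier = UNIV - {0}, mult = (*), one = 1\<rparr>"

text \<open>
  As elements of \<^const>\<open>hom\<close>, characters are arbitrary outside the unit group; the sums below
  evaluate them only on units.
\<close>

definition mult_character :: "nat \<Rightarrow> (int \<Rightarrow> complex) \<Rightarrow> bool" where
  "mult_character n \<chi> \<longleftrightarrow> \<chi> \<in> hom (units_of (zmod n)) complex_units"

definition add_character :: "nat \<Rightarrow> int \<Rightarrow> int \<Rightarrow> complex" where
  "add_character n a x = exp (2 * of_real pi * \<i> * of_int a * of_int x / of_nat n)"

definition gauss_sum :: "nat \<Rightarrow> (int \<Rightarrow> complex) \<Rightarrow> (int \<Rightarrow> complex) \<Rightarrow> complex" where
  "gauss_sum n \<chi> lam = (\<Sum>x\<in>Units (zmod n). \<chi> x * lam x)"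

definition gauss_sum_GL ::
    "nat \<Rightarrow> nat \<Rightarrow> (int \<Rightarrow> complex) \<Rightarrow> (int \<Rightarrow> complex) \<Rightarrow> complex" where
  "gauss_sum_GL r n \<chi> lam = (\<Sum>X\<in>GL r n. \<chi> (det_mod n X) * lam (tr_mod n X))"

lemma zmod_cring:
  assumes "n \<ge> 1"
  shows "cring (zmod n)"
proof -
  have n: "int n > 0" using assms by simp
  show ?thesis
  proof (rule cringI)
    show "abelian_group (zmod n)"
    proof (rule abelian_groupI)
      fix x assume x: "x \<in> carrier (zmod n)"
      show "\<exists>y\<in>carrier (zmod n). y \<oplus>\<^bsub>zmod n\<^esub> x = \<zero>\<^bsub>zmod n\<^esub>"
        using n by (intro bexI[of _ "(- x) mod int n"]) (auto simp: zmod_def mod_simps)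
    qed (use n in \<open>auto simp: zmod_def mod_simps algebra_simps\<close>)
    show "Group.comm_monoid (zmod n)"
      by (rule comm_monoidI) (use n in \<open>auto simp: zmod_def mod_simps algebra_simps\<close>)
  qed (use n in \<open>auto simp: zmod_def mod_simps algebra_simps\<close>)
qed

lemma finite_GL: "finite (GL r n)"
proof -
  let ?S = "{A \<in> carrier_mat r r. elements_mat A \<subseteq> {0..<int n}}"
  have "A \<in> (\<lambda>f. mat r r f) ` (({..<r} \<times> {..<r}) \<rightarrow>\<^sub>E {0..<int n})" if "A \<in> ?S" for A
  proof -
    let ?f = "restrict (\<lambda>p. A $$ p) ({..<r} \<times> {..<r})"
    have "A = mat r r ?f" using that by (intro eq_matI) auto
    moreover have "?f \<in> ({..<r} \<times> {..<r}) \<rightarrow>\<^sub>E {0..<int n}"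
    proof (rule restrict_PiE_iff[THEN iffD2], safe)
      fix i j assume "i < r" "j < r"
      then have "A $$ (i, j) \<in> elements_mat A" using that by auto
      then show "A $$ (i, j) \<in> {0..<int n}" using that by blast
    qed
    ultimately show ?thesis by blast
  qed
  then have "?S \<subseteq> (\<lambda>f. mat r r f) ` (({..<r} \<times> {..<r}) \<rightarrow>\<^sub>E {0..<int n})"
    by blast
  then have "finite ?S"
    by (rule finite_subset) (intro finite_imageI finite_PiE, auto)
  then show ?thesis
    by (rule finite_subset[rotated]) (auto simp: GL_def Units_def mat_monoid_def zmod_def)
qed

lemma det_reduce_mat: "det (reduce_mat n A) mod int n = det A mod int n"
proof (cases "dim_row A = dim_col A")
  case True
  have "(\<Prod>i = 0..<dim_row A. (A $$ (i, p i)) mod int n) mod int n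
      = (\<Prod>i = 0..<dim_row A. A $$ (i, p i)) mod int n" for p
    by (rule mod_prod_eq)
  then have t: "(signof p * (\<Prod>i = 0..<dim_row A. (A $$ (i, p i)) mod int n)) mod int n
      = (signof p * (\<Prod>i = 0..<dim_row A. A $$ (i, p i))) mod int n" for p :: "nat \<Rightarrow> nat"
    by (metis mod_mult_right_eq)
  have e: "(\<Prod>i = 0..<dim_row A. reduce_mat n A $$ (i, p i))
      = (\<Prod>i = 0..<dim_row A. (A $$ (i, p i)) mod int n)" if "p permutes {0..<dim_row A}" for p
    using True permutes_in_image[OF that]
    by (intro prod.cong) (auto simp: reduce_mat_def)
  have "det (reduce_mat n A) = (\<Sum>p | p permutes {0..<dim_row A}.
      signof p * (\<Prod>i = 0..<dim_row A. (A $$ (i, p i)) mod int n))"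
    unfolding det_def using True e by (auto simp: reduce_mat_def intro!: sum.cong)
  moreover have "det A = (\<Sum>p | p permutes {0..<dim_row A}.
      signof p * (\<Prod>i = 0..<dim_row A. A $$ (i, p i)))"
    unfolding det_def using True by simp
  ultimately show ?thesis by (metis (no_types, lifting) mod_sum_eq sum.cong t)
qed (simp add: det_def reduce_mat_def)

lemma det_mod_GL:
  assumes "n \<ge> 1" and "A \<in> GL r n"
  shows "det_mod n A \<in> Units (zmod n)"
proof -
  from assms(2) obtain B where A: "A \<in> carrier_mat r r" and B: "B \<in> carrier_mat r r"
    and BA: "reduce_mat n (B * A) = reduce_mat n (1\<^sub>m r)"
    and AB: "reduce_mat n (A * B) = reduce_mat n (1\<^sub>m r)"
    by (auto simp: GL_def Units_def mat_monoid_def)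
  have "(det B * det A) mod int n = 1 mod int n" "(det A * det B) mod int n = 1 mod int n"
    using det_reduce_mat[of n "B * A"] det_reduce_mat[of n "A * B"] det_reduce_mat[of n "1\<^sub>m r"]
      AB BA det_mult[OF A B] det_mult[OF B A] by auto
  then show ?thesis using assms(1)
    by (auto simp: Units_def zmod_def det_mod_def mod_simps intro!: bexI[of _ "det B mod int n"])
qed

end

theory Submission
  imports Defs "HOL-Number_Theory.Cong"
begin

text \<open>
  For a unitriangular \<open>u\<close> the substitution \<open>X \<mapsto> X u\<close> permutes the general linear group and keeps
  the determinant, so the sum may be averaged over all upper unitriangular \<open>u\<close>. As
  \<open>tr (X u) = tr X + (\<Sum>j<i. X i j * u j i)\<close> and the additive character is primitive, orthogonality
  makes the average vanish unless \<open>X\<close> is upper triangular. The sum over invertible upper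
  triangular matrices factors into \<open>r\<close> classical Gauss sums and \<open>r (r - 1) / 2\<close> free entries.
\<close>

section \<open>Additive characters\<close>

text \<open>Writes the argument as a real multiple of \<open>2 * pi\<close>, so that the periodicity
  of \<open>cis\<close> and \<open>cos\<close> can be applied.\<close>

lemma add_character_cis: "add_character n a x = cis (2 * pi * (of_int (a * x) / of_nat n))"
  by (simp add: add_character_def cis_conv_exp mult_ac)

lemma add_character_0 [simp]: "add_character n a 0 = 1"
  by (simp add: add_character_def)

lemma add_character_add:
  "add_character n a (x + y) = add_character n a x * add_character n a y"
  by (simp add: add_character_cis cis_mult algebra_simps add_divide_distrib)

lemma add_character_sum:
  "add_character n a (sum f A) = (\<Prod>x\<in>A. add_character n a (f x))"
  by (induction A rule: infinite_finite_induct) (auto simp: add_character_add)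

lemma add_character_mult_nat: "add_character n a (x * int k) = add_character n a x ^ k"
  by (induction k) (auto simp: algebra_simps add_character_add)

lemma add_character_multiple [simp]:
  assumes "n \<ge> 1"
  shows "add_character n a (int n * k) = 1"
proof -
  have "real_of_int (a * (int n * k)) / real n = real_of_int (a * k)"
    using assms by simp
  then show ?thesis
    by (simp only: add_character_cis cis_multiple_2pi Ints_of_int)
qed

text \<open>This is the primitivity of the character: the value is 1 exactly when
  \<open>a * x / n\<close> is an integer, and \<open>a\<close>, being coprime to \<open>n\<close>,
  cancels from the divisibility.\<close>

lemma add_character_eq_1_iff:
  assumes "n \<ge> 1" "coprime a (int n)"
  shows "add_character n a x = 1 \<longleftrightarrow> int n dvd x"
proof
  assume "add_character n a x = 1"
  \<comment> \<open>Real parts suffice, since the cosine is 1 only at integer multiples of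
    \<open>2 * pi\<close>.\<close>
  then have "cos (2 * pi * (of_int (a * x) / of_nat n)) = 1"
    unfolding add_character_cis by (metis cis.sel(1) one_complex.sel(1))
  then obtain k :: int where "2 * pi * (of_int (a * x) / of_nat n) = of_int k * 2 * pi"
    by (auto simp: cos_one_2pi_int)
  then have "of_int (a * x) = real_of_int (k * int n)"
    using assms(1) by (simp add: field_simps)
  then have "a * x = k * int n"
    by linarith
  then have "int n dvd a * x"
    by simp
  then show "int n dvd x"
    using assms(2) by (simp add: coprime_dvd_mult_right_iff coprime_commute)
next
  assume "int n dvd x"
  then obtain k where "x = int n * k" by blast
  then show "add_character n a x = 1"
    using assms(1) by simp
qed

text \<open>The character is defined on all integers; periodicity makes it a function of the residue
  class, so traces may be computed over the integers.\<close>

lemma add_character_mod: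
  assumes "n \<ge> 1"
  shows "add_character n a (x mod int n) = add_character n a x"
  using add_character_add[of n a "int n * (x div int n)" "x mod int n"] assms by simp

text \<open>Orthogonality: with \<open>z = add_character n a x\<close> this is a geometric sum of
  ratio \<open>z\<close>. Since \<open>z ^ n = 1\<close>, it vanishes unless \<open>z = 1\<close>,
  and by primitivity that means \<open>n\<close> divides \<open>x\<close>.\<close>

lemma sum_add_character:
  assumes "n \<ge> 1" "coprime a (int n)"
  shows "(\<Sum>y\<in>{0..<int n}. add_character n a (x * y)) = (if int n dvd x then of_nat n else 0)"
proof -
  let ?z = "add_character n a x"
  have "(\<Sum>y\<in>{0..<int n}. add_character n a (x * y)) = (\<Sum>k<n. ?z ^ k)"
    unfolding add_character_mult_nat[symmetric]
    by (rule sum.reindex_bij_witness[of _ int nat]) auto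
  moreover have "?z ^ n = 1"
    unfolding add_character_mult_nat[symmetric] using add_character_eq_1_iff[OF assms] by simp
  ultimately show ?thesis
    using add_character_eq_1_iff[OF assms, of x] by (auto simp: sum_gp_strict)
qed

section \<open>Multiplicative characters\<close>

text \<open>Bezout gives an integer inverse, which is then reduced modulo \<open>n\<close>. For
  \<open>n = 1\<close> the only residue 0 is coprime to 1 and is indeed a unit of the zero
  ring.\<close>

lemma Units_zmod:
  assumes "n \<ge> 1"
  shows "Units (zmod n) = {x \<in> {0..<int n}. coprime x (int n)}"
proof -
  have "(\<exists>y\<in>{0..<int n}. (y * x) mod int n = 1 mod int n \<and> (x * y) mod int n = 1 mod int n)
      \<longleftrightarrow> (\<exists>y. [x * y = 1] (mod int n))" for x
  proof
    assume "\<exists>y. [x * y = 1] (mod int n)"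
    then obtain y where "[x * y = 1] (mod int n)" by blast
    then show "\<exists>y\<in>{0..<int n}. (y * x) mod int n = 1 mod int n \<and> (x * y) mod int n = 1 mod int n"
      using assms by (intro bexI[of _ "y mod int n"]) (auto simp: cong_def mod_simps mult.commute)
  qed (auto simp: cong_def)
  then show ?thesis
    by (auto simp: Units_def zmod_def coprime_iff_invertible_int)
qed

lemma mult_character_mult:
  assumes "mult_character n \<chi>" "x \<in> Units (zmod n)" "y \<in> Units (zmod n)"
  shows "\<chi> ((x * y) mod int n) = \<chi> x * \<chi> y"
  using assms by (auto simp: mult_character_def hom_def units_of_def complex_units_def zmod_def)

text \<open>The value is nonzero and equal to its own square.\<close>

lemma mult_character_one:
  assumes "n \<ge> 1" "mult_character n \<chi>"
  shows "\<chi> (1 mod int n) = 1"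
proof -
  have u: "1 mod int n \<in> Units (zmod n)"
    using assms(1) by (auto simp: Units_zmod)
  have "\<chi> (1 mod int n) \<noteq> 0"
    using assms(2) u
    by (auto simp: mult_character_def hom_def units_of_def complex_units_def Pi_iff)
  moreover have "\<chi> (1 mod int n) = \<chi> (1 mod int n) * \<chi> (1 mod int n)"
    using mult_character_mult[OF assms(2) u u] by (simp add: mod_simps)
  ultimately show ?thesis by simp
qed

lemma mult_character_prod:
  assumes n: "n \<ge> 1" and \<chi>: "mult_character n \<chi>" and "\<And>i. i \<in> A \<Longrightarrow> d i \<in> Units (zmod n)"
  shows "\<chi> ((\<Prod>i\<in>A. d i) mod int n) = (\<Prod>i\<in>A. \<chi> (d i))"
  using assms(3)
proof (induction A rule: infinite_finite_induct)
  case (insert i A)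
  have "(\<Prod>i\<in>A. d i) mod int n \<in> Units (zmod n)"
    using insert.prems n by (auto simp: Units_zmod intro!: prod_coprime_left)
  with insert show ?case
    using mult_character_mult[OF \<chi>, of "d i" "(\<Prod>i\<in>A. d i) mod int n"]
    by (simp add: mod_simps)
qed (use mult_character_one[OF n \<chi>] in auto)

section \<open>The general linear group\<close>

lemma mat_monoid_carrier_iff:
  "A \<in> carrier (mat_monoid r n) \<longleftrightarrow>
     A \<in> carrier_mat r r \<and> (\<forall>i<r. \<forall>j<r. A $$ (i, j) \<in> {0..<int n})"
  by (auto simp: mat_monoid_def zmod_def elements_mat_def UN_subset_iff image_subset_iff)

lemma reduce_mat_carrier:
  assumes "n \<ge> 1" "A \<in> carrier_mat r r"
  shows "reduce_mat n A \<in> carrier (mat_monoid r n)"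
  using assms by (auto simp: mat_monoid_carrier_iff reduce_mat_def)

lemma reduce_mat_id:
  assumes "A \<in> carrier (mat_monoid r n)"
  shows "reduce_mat n A = A"
  using assms by (intro eq_matI) (auto simp: mat_monoid_carrier_iff reduce_mat_def)

text \<open>Together with its mirror image below, this lets products in the monoid be computed over
  the integers and reduced once at the end, so that associativity and determinants of integer
  matrices are available.\<close>

lemma reduce_mat_mult_left:
  assumes "A \<in> carrier_mat r r" "B \<in> carrier_mat r r"
  shows "reduce_mat n (reduce_mat n A * B) = reduce_mat n (A * B)"
proof (intro eq_matI)
  fix i j assume "i < dim_row (reduce_mat n (A * B))" "j < dim_col (reduce_mat n (A * B))"
  then have ij: "i < r" "j < r" using assms by (auto simp: reduce_mat_def)
  have "(\<Sum>k<r. (A $$ (i, k) mod int n) * B $$ (k, j)) mod int n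
      = (\<Sum>k<r. ((A $$ (i, k) mod int n) * B $$ (k, j)) mod int n) mod int n"
    by (rule mod_sum_eq[symmetric])
  also have "\<dots> = (\<Sum>k<r. A $$ (i, k) * B $$ (k, j)) mod int n"
    by (simp add: mod_simps mod_sum_eq)
  finally show "reduce_mat n (reduce_mat n A * B) $$ (i, j) = reduce_mat n (A * B) $$ (i, j)"
    using ij assms by (simp add: reduce_mat_def scalar_prod_def lessThan_atLeast0)
qed (use assms in \<open>auto simp: reduce_mat_def\<close>)

lemma reduce_mat_mult_right:
  assumes "A \<in> carrier_mat r r" "B \<in> carrier_mat r r"
  shows "reduce_mat n (A * reduce_mat n B) = reduce_mat n (A * B)"
proof (intro eq_matI)
  fix i j assume "i < dim_row (reduce_mat n (A * B))" "j < dim_col (reduce_mat n (A * B))"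
  then have ij: "i < r" "j < r" using assms by (auto simp: reduce_mat_def)
  have "(\<Sum>k<r. A $$ (i, k) * (B $$ (k, j) mod int n)) mod int n
      = (\<Sum>k<r. (A $$ (i, k) * (B $$ (k, j) mod int n)) mod int n) mod int n"
    by (rule mod_sum_eq[symmetric])
  also have "\<dots> = (\<Sum>k<r. A $$ (i, k) * B $$ (k, j)) mod int n"
    by (simp add: mod_simps mod_sum_eq)
  finally show "reduce_mat n (A * reduce_mat n B) $$ (i, j) = reduce_mat n (A * B) $$ (i, j)"
    using ij assms by (simp add: reduce_mat_def scalar_prod_def lessThan_atLeast0)
qed (use assms in \<open>auto simp: reduce_mat_def\<close>)

text \<open>A unit has a unit determinant by \<open>det_mod_GL\<close>. Conversely, Cramer's rule
  applies: the adjugate, scaled by an inverse \<open>c\<close> of the determinant modulo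
  \<open>n\<close>, is a two-sided inverse after reduction.\<close>

lemma GL_iff_coprime_det:
  assumes "n \<ge> 1"
  shows "A \<in> GL r n \<longleftrightarrow> A \<in> carrier (mat_monoid r n) \<and> coprime (det A) (int n)"
proof
  assume "A \<in> GL r n"
  then have "A \<in> carrier (mat_monoid r n)" "coprime (det A mod int n) (int n)"
    using det_mod_GL[OF assms, of A r]
    by (auto simp: Units_zmod[OF assms] det_mod_def) (simp add: GL_def Units_def)
  then show "A \<in> carrier (mat_monoid r n) \<and> coprime (det A) (int n)"
    using assms by simp
next
  assume A: "A \<in> carrier (mat_monoid r n) \<and> coprime (det A) (int n)"
  then have Ac: "A \<in> carrier_mat r r" by (simp add: mat_monoid_carrier_iff)
  obtain c where c: "[det A * c = 1] (mod int n)"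
    using A by (auto simp: coprime_iff_invertible_int)
  define C where "C = c \<cdot>\<^sub>m adj_mat A"
  have C: "C \<in> carrier_mat r r" using adj_mat[OF Ac] by (simp add: C_def)
  have one: "reduce_mat n ((c * det A) \<cdot>\<^sub>m 1\<^sub>m r) = reduce_mat n (1\<^sub>m r)"
    using c by (intro eq_matI) (auto simp: reduce_mat_def cong_def mult.commute)
  have smult: "c \<cdot>\<^sub>m (det A \<cdot>\<^sub>m 1\<^sub>m r) = (c * det A) \<cdot>\<^sub>m 1\<^sub>m r"
    by (intro eq_matI) auto
  have CA: "C * A = (c * det A) \<cdot>\<^sub>m 1\<^sub>m r"
    using adj_mat[OF Ac] Ac by (simp add: C_def smult mult_smult_assoc_mat[of _ r r])
  have AC: "A * C = (c * det A) \<cdot>\<^sub>m 1\<^sub>m r"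
    using adj_mat[OF Ac] Ac by (simp add: C_def smult mult_smult_distrib[of _ r r])
  have "reduce_mat n (reduce_mat n C * A) = reduce_mat n (1\<^sub>m r)"
    "reduce_mat n (A * reduce_mat n C) = reduce_mat n (1\<^sub>m r)"
    using reduce_mat_mult_left[OF C Ac] reduce_mat_mult_right[OF Ac C] one CA AC by simp_all
  moreover have "reduce_mat n C \<in> carrier (mat_monoid r n)"
    by (rule reduce_mat_carrier[OF assms C])
  ultimately show "A \<in> GL r n"
    using A by (auto simp: GL_def Units_def mat_monoid_def)
qed

lemma reduce_mat_mult_GL:
  assumes n: "n \<ge> 1" and X: "X \<in> GL r n" and U: "U \<in> carrier_mat r r" "det U = 1"
  shows "reduce_mat n (X * U) \<in> GL r n"
    and "det_mod n (reduce_mat n (X * U)) = det_mod n X"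
proof -
  have Xc: "X \<in> carrier_mat r r"
    using X n by (simp add: GL_iff_coprime_det mat_monoid_carrier_iff)
  show *: "det_mod n (reduce_mat n (X * U)) = det_mod n X"
    using det_mult[OF Xc U(1)] U(2) by (simp add: det_mod_def det_reduce_mat)
  have "coprime (det (reduce_mat n (X * U)) mod int n) (int n)"
    using * X n by (simp add: det_mod_def GL_iff_coprime_det)
  then show "reduce_mat n (X * U) \<in> GL r n"
    using n Xc U by (simp add: GL_iff_coprime_det reduce_mat_carrier)
qed

text \<open>Right multiplication by \<open>U\<close> permutes the group: as
  \<open>det U = 1\<close>, the adjugate is an integer inverse of \<open>U\<close>, and multiplying
  by it undoes the substitution.\<close>

lemma sum_GL_mult_right:
  assumes n: "n \<ge> 1" and U: "U \<in> carrier_mat r r" "det U = 1"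
  shows "(\<Sum>X\<in>GL r n. F (reduce_mat n (X * U))) = (\<Sum>X\<in>GL r n. F X)"
proof -
  have V: "adj_mat U \<in> carrier_mat r r" "U * adj_mat U = 1\<^sub>m r" "adj_mat U * U = 1\<^sub>m r"
    using adj_mat[OF U(1)] U(2) by auto
  have "det (adj_mat U) = 1"
    using det_mult[OF U(1) V(1)] V(2) U(2) by simp
  note V = V this
  \<comment> \<open>Stated for any pair with \<open>A * B = 1\<close>, to serve both directions of
    the bijection: \<open>U\<close> followed by its adjugate, and the reverse.\<close>
  have inv: "reduce_mat n (reduce_mat n (X * A) * B) = X"
    if "X \<in> GL r n" "A \<in> carrier_mat r r" "B \<in> carrier_mat r r" "A * B = 1\<^sub>m r" for X A B
  proof -
    have X: "X \<in> carrier (mat_monoid r n)" "X \<in> carrier_mat r r"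
      using that(1) n by (auto simp: GL_iff_coprime_det mat_monoid_carrier_iff)
    show ?thesis
      using that X reduce_mat_mult_left[of "X * A" r B n] reduce_mat_id[OF X(1)]
      by (simp add: assoc_mult_mat[of _ r r _ r _ r])
  qed
  show ?thesis
    by (rule sum.reindex_bij_witness[of _ "\<lambda>X. reduce_mat n (X * adj_mat U)"
          "\<lambda>X. reduce_mat n (X * U)"])
      (use inv U V n in \<open>auto intro: reduce_mat_mult_GL\<close>)
qed

section \<open>Upper triangular matrices\<close>

text \<open>
  The pair \<open>(i, j)\<close> with \<open>j < i\<close> stands for a position below the diagonal; the entry \<open>f (i, j)\<close>
  is placed at the transposed position, where the trace pairs it with the entry at \<open>(i, j)\<close>.
\<close>

definition lower_positions :: "nat \<Rightarrow> (nat \<times> nat) set" where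
  "lower_positions r = (SIGMA i:{..<r}. {..<i})"

definition upper_mat :: "nat \<Rightarrow> (nat \<Rightarrow> int) \<Rightarrow> (nat \<times> nat \<Rightarrow> int) \<Rightarrow> int mat" where
  "upper_mat r d f = mat r r (\<lambda>(i, j). if i = j then d i else if i < j then f (j, i) else 0)"

lemma finite_lower_positions [simp]: "finite (lower_positions r)"
  by (simp add: lower_positions_def)

lemma card_lower_positions: "card (lower_positions r) = r * (r - 1) div 2"
  by (simp add: lower_positions_def Sum_Ico_nat lessThan_atLeast0)

lemma upper_mat_carrier [simp]: "upper_mat r d f \<in> carrier_mat r r"
  by (simp add: upper_mat_def)

lemma det_upper_mat: "det (upper_mat r d f) = (\<Prod>i<r. d i)"
proof -
  have "det (upper_mat r d f) = prod_list (diag_mat (upper_mat r d f))"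
    by (rule det_upper_triangular[of _ r]) (auto simp: upper_mat_def)
  also have "\<dots> = (\<Prod>i<r. d i)"
    by (simp add: prod_list_diag_prod) (simp add: upper_mat_def lessThan_atLeast0)
  finally show ?thesis .
qed

text \<open>The determinant is the product of the diagonal, and a product is coprime to
  \<open>n\<close> iff every factor is. The entries above the diagonal only have to be
  residues.\<close>

lemma upper_mat_GL_iff:
  assumes "n \<ge> 1"
  shows "upper_mat r d f \<in> GL r n \<longleftrightarrow>
    (\<forall>i<r. d i \<in> Units (zmod n)) \<and> (\<forall>p\<in>lower_positions r. f p \<in> {0..<int n})"
proof -
  have "coprime (\<Prod>i<r. d i) (int n) \<longleftrightarrow> (\<forall>i<r. coprime (d i) (int n))"
    by (auto intro: prod_coprime_left dest: coprime_divisors[of "d _" "\<Prod>i<r. d i" "int n" "int n", rotated 2])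
  moreover have "upper_mat r d f \<in> carrier (mat_monoid r n) \<longleftrightarrow>
      (\<forall>i<r. d i \<in> {0..<int n}) \<and> (\<forall>p\<in>lower_positions r. f p \<in> {0..<int n})" (is "?l \<longleftrightarrow> ?r")
  proof
    assume l: ?l
    show ?r
    proof safe
      fix i assume "i < r"
      then have "upper_mat r d f $$ (i, i) \<in> {0..<int n}"
        using l by (simp add: mat_monoid_carrier_iff)
      then show "d i \<in> {0..<int n}" using \<open>i < r\<close> by (simp add: upper_mat_def)
    next
      fix i j assume "(i, j) \<in> lower_positions r"
      then have ij: "j < i" "i < r" by (auto simp: lower_positions_def)
      then have "upper_mat r d f $$ (j, i) \<in> {0..<int n}"
        using l by (simp add: mat_monoid_carrier_iff)
      then show "f (i, j) \<in> {0..<int n}" using ij by (simp add: upper_mat_def)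
    qed
  next
    assume ?r
    then show ?l using assms
      by (auto simp: mat_monoid_carrier_iff upper_mat_def lower_positions_def)
  qed
  ultimately show ?thesis
    using assms by (auto simp: GL_iff_coprime_det det_upper_mat Units_zmod)
qed

text \<open>Row \<open>i\<close> of \<open>X\<close> meets column \<open>i\<close> of the
  unitriangular factor, which holds 1 on the diagonal and \<open>f (i, j)\<close> above it. The
  entries of \<open>X\<close> below the diagonal thus become the coefficients of the free parameters
  \<open>f\<close>.\<close>

lemma trace_mult_upper_mat:
  assumes "X \<in> carrier_mat r r"
  shows "(\<Sum>i<r. (X * upper_mat r (\<lambda>_. 1) f) $$ (i, i))
       = (\<Sum>i<r. X $$ (i, i)) + (\<Sum>p\<in>lower_positions r. X $$ p * f p)"
proof -
  have "(X * upper_mat r (\<lambda>_. 1) f) $$ (i, i) = X $$ (i, i) + (\<Sum>j<i. X $$ (i, j) * f (i, j))"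
    if "i < r" for i
  proof -
    have "(X * upper_mat r (\<lambda>_. 1) f) $$ (i, i)
        = (\<Sum>j<r. X $$ (i, j) * upper_mat r (\<lambda>_. 1) f $$ (j, i))"
      using assms that by (simp add: scalar_prod_def upper_mat_def lessThan_atLeast0)
    \<comment> \<open>Positions \<open>(j, i)\<close> with \<open>j > i\<close> lie below the
      diagonal, where \<open>upper_mat\<close> is 0; the bound \<open>Suc i\<close> keeps the
      diagonal term.\<close>
    also have "\<dots> = (\<Sum>j<Suc i. X $$ (i, j) * upper_mat r (\<lambda>_. 1) f $$ (j, i))"
      using that by (intro sum.mono_neutral_right) (auto simp: upper_mat_def)
    also have "\<dots> = X $$ (i, i) + (\<Sum>j<i. X $$ (i, j) * f (i, j))"
      using that by (simp add: upper_mat_def)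
    finally show ?thesis .
  qed
  then show ?thesis
    by (simp add: sum.distrib lower_positions_def sum.Sigma)
qed

text \<open>An invertible upper triangular matrix amounts to a choice of unit diagonal entries and
  arbitrary entries above them. Extensional functions make \<open>d\<close> and \<open>f\<close>
  unique, since their values off the index sets are fixed.\<close>

lemma sum_upper_GL:
  assumes n: "n \<ge> 1"
  shows "(\<Sum>X | X \<in> GL r n \<and> (\<forall>p\<in>lower_positions r. X $$ p = 0). F X)
       = (\<Sum>(d, f)\<in>({..<r} \<rightarrow>\<^sub>E Units (zmod n)) \<times> (lower_positions r \<rightarrow>\<^sub>E {0..<int n}).
            F (upper_mat r d f))" (is "sum F ?T = _")
proof (rule sum.reindex_bij_witness[of _ "\<lambda>(d, f). upper_mat r d f"
      "\<lambda>X. (restrict (\<lambda>i. X $$ (i, i)) {..<r}, restrict (\<lambda>(i, j). X $$ (j, i)) (lower_positions r))"])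
  fix X assume X: "X \<in> ?T"
  let ?d = "restrict (\<lambda>i. X $$ (i, i)) {..<r}"
  let ?f = "restrict (\<lambda>(i, j). X $$ (j, i)) (lower_positions r)"
  have Xc: "X \<in> carrier_mat r r"
    using X n by (simp add: GL_iff_coprime_det mat_monoid_carrier_iff)
  have eq: "upper_mat r ?d ?f = X"
    using X Xc by (intro eq_matI) (auto simp: upper_mat_def lower_positions_def)
  then have "upper_mat r ?d ?f \<in> GL r n" using X by simp
  then show "(?d, ?f) \<in> ({..<r} \<rightarrow>\<^sub>E Units (zmod n)) \<times> (lower_positions r \<rightarrow>\<^sub>E {0..<int n})"
    using upper_mat_GL_iff[OF n, of r ?d ?f] by (auto simp del: atLeastLessThan_iff)
  show "(case (?d, ?f) of (d, f) \<Rightarrow> upper_mat r d f) = X"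
    using eq by simp
  show "(case (?d, ?f) of (d, f) \<Rightarrow> F (upper_mat r d f)) = F X"
    using eq by simp
next
  fix p assume "p \<in> ({..<r} \<rightarrow>\<^sub>E Units (zmod n)) \<times> (lower_positions r \<rightarrow>\<^sub>E {0..<int n})"
  then obtain d f where p: "p = (d, f)" and d: "d \<in> {..<r} \<rightarrow>\<^sub>E Units (zmod n)"
    and f: "f \<in> lower_positions r \<rightarrow>\<^sub>E {0..<int n}" by auto
  let ?X = "upper_mat r d f"
  have "restrict (\<lambda>i. ?X $$ (i, i)) {..<r} = d"
    using d by (intro ext) (auto simp: upper_mat_def PiE_def extensional_def)
  moreover have "restrict (\<lambda>(i, j). ?X $$ (j, i)) (lower_positions r) = f"
  proof
    fix q show "restrict (\<lambda>(i, j). ?X $$ (j, i)) (lower_positions r) q = f q"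
    proof (cases "q \<in> lower_positions r")
      case True
      then show ?thesis by (auto simp: upper_mat_def lower_positions_def)
    next
      case False
      then show ?thesis using PiE_arb[OF f] by simp
    qed
  qed
  ultimately show "(\<lambda>X. (restrict (\<lambda>i. X $$ (i, i)) {..<r},
      restrict (\<lambda>(i, j). X $$ (j, i)) (lower_positions r))) (case p of (d, f) \<Rightarrow> upper_mat r d f) = p"
    by (simp add: p)
  have "?X \<in> GL r n"
    using d f n by (auto simp: upper_mat_GL_iff PiE_mem simp del: atLeastLessThan_iff)
  then show "(case p of (d, f) \<Rightarrow> upper_mat r d f) \<in> ?T"
    by (auto simp: p upper_mat_def lower_positions_def)
qed

section \<open>The Gauss sum of the general linear group\<close>

lemma add_character_tr_mod:
  assumes "n \<ge> 1" "X \<in> carrier_mat r r"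
  shows "add_character n a (tr_mod n X) = add_character n a (\<Sum>i<r. X $$ (i, i))"
  using assms by (simp add: tr_mod_def add_character_mod)

lemma add_character_tr_mod_reduce_mat:
  assumes "n \<ge> 1" "X \<in> carrier_mat r r"
  shows "add_character n a (tr_mod n (reduce_mat n X)) = add_character n a (\<Sum>i<r. X $$ (i, i))"
proof -
  have "tr_mod n (reduce_mat n X) = (\<Sum>i<r. X $$ (i, i)) mod int n"
    using assms by (simp add: tr_mod_def reduce_mat_def mod_sum_eq)
  then show ?thesis using assms by (simp add: add_character_mod)
qed

text \<open>The character turns the trace formula into a product over positions, so the sum over
  \<open>f\<close> is a product of independent sums over single residues. Orthogonality kills it as
  soon as one entry of \<open>X\<close> below the diagonal is nonzero.\<close>

lemma sum_unitriangular_add_character: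
  assumes n: "n \<ge> 1" and a: "coprime a (int n)" and X: "X \<in> GL r n"
  shows "(\<Sum>f\<in>lower_positions r \<rightarrow>\<^sub>E {0..<int n}.
            add_character n a (tr_mod n (reduce_mat n (X * upper_mat r (\<lambda>_. 1) f))))
       = (if \<forall>p\<in>lower_positions r. X $$ p = 0
          then add_character n a (tr_mod n X) * of_nat n ^ card (lower_positions r) else 0)"
proof -
  let ?e = "add_character n a" and ?P = "lower_positions r"
  have X': "X \<in> carrier_mat r r" "\<And>i j. i < r \<Longrightarrow> j < r \<Longrightarrow> X $$ (i, j) \<in> {0..<int n}"
    using X n by (auto simp: GL_iff_coprime_det mat_monoid_carrier_iff)
  \<comment> \<open>Entries are representatives in \<open>{0..<int n}\<close>, so being divisible by
    \<open>n\<close> means being 0.\<close>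
  have dvd: "int n dvd X $$ p \<longleftrightarrow> X $$ p = 0" if "p \<in> ?P" for p
  proof -
    have "X $$ p \<in> {0..<int n}" using that X'(2) by (auto simp: lower_positions_def)
    then show ?thesis by (auto dest: zdvd_imp_le)
  qed
  have "(\<Sum>f\<in>?P \<rightarrow>\<^sub>E {0..<int n}. ?e (tr_mod n (reduce_mat n (X * upper_mat r (\<lambda>_. 1) f))))
      = (\<Sum>f\<in>?P \<rightarrow>\<^sub>E {0..<int n}. ?e (tr_mod n X) * (\<Prod>p\<in>?P. ?e (X $$ p * f p)))"
    using n X'(1)
    by (simp add: add_character_tr_mod_reduce_mat[where r = r] trace_mult_upper_mat
        add_character_tr_mod[where r = r] add_character_add add_character_sum mult_carrier_mat[of _ r r])
  also have "\<dots> = ?e (tr_mod n X) * (\<Prod>p\<in>?P. \<Sum>y\<in>{0..<int n}. ?e (X $$ p * y))"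
    by (subst prod_sum_PiE) (auto simp: sum_distrib_left)
  also have "(\<Prod>p\<in>?P. \<Sum>y\<in>{0..<int n}. ?e (X $$ p * y))
      = (\<Prod>p\<in>?P. if X $$ p = 0 then of_nat n else 0)"
    by (intro prod.cong) (auto simp: sum_add_character[OF n a] dvd)
  also have "\<dots> = (if \<forall>p\<in>?P. X $$ p = 0 then of_nat n ^ card ?P else 0)"
    by auto
  finally show ?thesis by simp
qed

text \<open>Averaging over all unitriangular factors: the sum is repeated once for each
  \<open>f\<close>, the substitution is made in each copy, and after swapping the sums only upper
  triangular \<open>X\<close> survive.\<close>

lemma gauss_sum_GL_upper:
  assumes n: "n \<ge> 1" and a: "coprime a (int n)"
  shows "gauss_sum_GL r n \<chi> (add_character n a)
       = (\<Sum>X | X \<in> GL r n \<and> (\<forall>p\<in>lower_positions r. X $$ p = 0).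
            \<chi> (det_mod n X) * add_character n a (tr_mod n X))"
proof -
  let ?e = "add_character n a" and ?P = "lower_positions r"
  let ?S = "?P \<rightarrow>\<^sub>E {0..<int n}" and ?U = "upper_mat r (\<lambda>_. 1)"
  have "of_nat n ^ card ?P * gauss_sum_GL r n \<chi> ?e = (\<Sum>f\<in>?S. gauss_sum_GL r n \<chi> ?e)"
    by (simp add: card_funcsetE)
  also have "\<dots> = (\<Sum>f\<in>?S. \<Sum>X\<in>GL r n. \<chi> (det_mod n X) * ?e (tr_mod n (reduce_mat n (X * ?U f))))"
  proof (rule sum.cong)
    fix f
    have "det (?U f) = 1" by (simp add: det_upper_mat)
    then show "gauss_sum_GL r n \<chi> ?e
        = (\<Sum>X\<in>GL r n. \<chi> (det_mod n X) * ?e (tr_mod n (reduce_mat n (X * ?U f))))"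
      unfolding gauss_sum_GL_def
      by (subst sum_GL_mult_right[OF n upper_mat_carrier, symmetric])
        (auto simp: reduce_mat_mult_GL[OF n])
  qed simp
  also have "\<dots> = (\<Sum>X\<in>GL r n. \<chi> (det_mod n X) * (\<Sum>f\<in>?S. ?e (tr_mod n (reduce_mat n (X * ?U f)))))"
    by (subst sum.swap) (simp add: sum_distrib_left)
  also have "\<dots> = (\<Sum>X\<in>GL r n. if \<forall>p\<in>?P. X $$ p = 0
      then of_nat n ^ card ?P * (\<chi> (det_mod n X) * ?e (tr_mod n X)) else 0)"
    by (intro sum.cong) (auto simp: sum_unitriangular_add_character[OF n a])
  also have "\<dots> = of_nat n ^ card ?P * (\<Sum>X | X \<in> GL r n \<and> (\<forall>p\<in>?P. X $$ p = 0).
      \<chi> (det_mod n X) * ?e (tr_mod n X))"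
    by (simp add: sum.inter_filter[OF finite_GL, symmetric] sum_distrib_left)
  \<comment> \<open>The common factor, a power of \<open>n\<close>, is nonzero and cancels.\<close>
  finally show ?thesis using n by simp
qed

theorem theorem1:
  fixes n r :: nat and a :: int and \<chi> :: "int \<Rightarrow> complex"
  assumes "n \<ge> 1" and "r \<ge> 1"
    and "mult_character n \<chi>"
    and "gcd a (int n) = 1"
  shows "gauss_sum_GL r n \<chi> (add_character n a)
       = gauss_sum n \<chi> (add_character n a) ^ r * of_nat n ^ (r * (r - 1) div 2)"
proof -
  let ?e = "add_character n a" and ?P = "lower_positions r"
  let ?D = "{..<r} \<rightarrow>\<^sub>E Units (zmod n)" and ?S = "?P \<rightarrow>\<^sub>E {0..<int n}"
  note n = assms(1)
  have a: "coprime a (int n)" using assms(4) by (simp add: coprime_iff_gcd_eq_1)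
  have fin: "finite (Units (zmod n))"
    by (rule finite_subset[of _ "{0..<int n}"]) (auto simp: Units_zmod[OF n])
  have "gauss_sum_GL r n \<chi> ?e
      = (\<Sum>(d, f)\<in>?D \<times> ?S. \<chi> (det_mod n (upper_mat r d f)) * ?e (tr_mod n (upper_mat r d f)))"
    unfolding gauss_sum_GL_upper[OF n a] by (rule sum_upper_GL[OF n])
  \<comment> \<open>Determinant and trace of a triangular matrix are the product and the sum of its
    diagonal, so the summand does not depend on \<open>f\<close> and splits into one factor for each
    diagonal entry.\<close>
  also have "\<dots> = (\<Sum>(d, f)\<in>?D \<times> ?S. \<Prod>i<r. \<chi> (d i) * ?e (d i))"
  proof (intro sum.cong refl, safe)
    fix d f assume d: "d \<in> ?D"
    have "\<chi> (det_mod n (upper_mat r d f)) = (\<Prod>i<r. \<chi> (d i))"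
      unfolding det_mod_def det_upper_mat using d
      by (intro mult_character_prod[OF n assms(3)]) auto
    moreover have "?e (tr_mod n (upper_mat r d f)) = (\<Prod>i<r. ?e (d i))"
      by (simp add: add_character_tr_mod[OF n upper_mat_carrier] add_character_sum)
        (simp add: upper_mat_def)
    ultimately show "\<chi> (det_mod n (upper_mat r d f)) * ?e (tr_mod n (upper_mat r d f))
        = (\<Prod>i<r. \<chi> (d i) * ?e (d i))"
      by (simp add: prod.distrib)
  qed
  \<comment> \<open>Each free entry above the diagonal contributes a factor
    \<open>n\<close>.\<close>
  also have "\<dots> = (\<Sum>d\<in>?D. \<Prod>i<r. \<chi> (d i) * ?e (d i)) * of_nat n ^ card ?P"
    by (simp add: sum.cartesian_product[symmetric] card_funcsetE sum_distrib_left mult.commute)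
  \<comment> \<open>The diagonal entries run independently over the units, so the sum of products is
    a product of \<open>r\<close> equal classical Gauss sums.\<close>
  also have "(\<Sum>d\<in>?D. \<Prod>i<r. \<chi> (d i) * ?e (d i)) = gauss_sum n \<chi> ?e ^ r"
    using prod_sum_PiE[of "{..<r}" "\<lambda>_. Units (zmod n)" "\<lambda>_ x. \<chi> x * ?e x"] fin
    by (simp add: gauss_sum_def)
  finally show ?thesis by (simp add: card_lower_positions)
qed

end
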